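(* For any Borel function $f \colon 2^{\mathbb{N}} \rightarrow 2^{\mathbb{N}}$, there exists a restriction $\rho$ on $2^{\mathbb{N}}$ preserving infinitely many variables such that $f^\rho$ is continuous.
   Context: A restriction is a function $\rho\colon\mathbb{N}\to\{0,1,*\}$; the variables $x_i$ with $\rho(i)=*$ are called preserved. For a function $f$ on $2^{\mathbb{N}}$, the restricted function $f^\rho$ has domain $2^{\rho^{-1}(\{*\})}$ (product topology): given values for the preserved variables, it evaluates $f$ on the input obtained by setting every other $x_i$ to $\rho(i)$. A function is Borel if preimages of open sets are Borel. *)

theory Defs
  imports "HOL-Analysis.Analysis"
begin

text \<open>
  Cantor space \<open>2\<^sup>\<nat>\<close> is the type \<^typ>\<open>nat \<Rightarrow> bool\<close> (with \<^const>\<open>False\<close> for 0 and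
  \<^const>\<open>True\<close> for 1). Its type class topology is the product of the discrete topologies
  on \<^typ>\<open>bool\<close>, and \<^const>\<open>borel\<close> is the sigma algebra generated by its open sets.
\<close>

text \<open>In a restriction, \<^const>\<open>None\<close> plays the role of the symbol \<open>*\<close>.\<close>

type_synonym restriction = "nat \<Rightarrow> bool option"

definition preserved :: "restriction \<Rightarrow> nat set" where
  "preserved \<rho> = {i. \<rho> i = None}"

text \<open>
  Points of the cube over the preserved variables are functions on \<^typ>\<open>nat\<close> that are
  \<^const>\<open>undefined\<close> outside \<open>preserved \<rho>\<close>, as usual for \<^const>\<open>product_topology\<close>.
\<close>

definition restricted_cube :: "restriction \<Rightarrow> (nat \<Rightarrow> bool) topology" where
  "restricted_cube \<rho> = product_topology (\<lambda>_. discrete_topology UNIV) (preserved \<rho>)"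

definition fill_in :: "restriction \<Rightarrow> (nat \<Rightarrow> bool) \<Rightarrow> nat \<Rightarrow> bool" where
  "fill_in \<rho> x = (\<lambda>i. case \<rho> i of None \<Rightarrow> x i | Some b \<Rightarrow> b)"

definition restricted_fun ::
    "((nat \<Rightarrow> bool) \<Rightarrow> 'a) \<Rightarrow> restriction \<Rightarrow> (nat \<Rightarrow> bool) \<Rightarrow> 'a" where
  "restricted_fun f \<rho> = (\<lambda>x \<in> topspace (restricted_cube \<rho>). f (fill_in \<rho> x))"

end

theory Submission
  imports Defs
begin

text \<open>
  A Borel function into a second countable space is continuous on some comeager set, because
  every Borel set coincides with an open set on a comeager set
  (\<open>borel_measurable_continuous_on_comeager\<close>). So it is enough to find, inside a given comeager
  subset of Cantor space, a subcube with infinitely many free coordinates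
  (\<open>comeager_contains_subcube\<close>); the corresponding restriction makes \<open>f\<close> continuous.

  Let \<open>D\<^sub>0, D\<^sub>1, \<dots>\<close> be dense open sets whose intersection lies in the comeager set. The subcube
  fixes finite blocks of coordinates one after the other and leaves one coordinate free after
  each block. The \<open>n\<close>-th block is chosen such that it forces membership in \<open>D\<^sub>n\<close> whatever the
  earlier coordinates are (\<open>dense_open_contains_block\<close>). Such a block exists because there are
  only finitely many assignments to the earlier coordinates: changing a coordinate is a
  homeomorphism, and so the points that stay in \<open>D\<^sub>n\<close> under all changes of those coordinates
  form a finite intersection of dense open sets. Since no block depends on the values of the
  free coordinates, every point of the subcube lies in every \<open>D\<^sub>n\<close>.
\<close>

section \<open>Comeager sets and Borel functions\<close>

definition comeager :: "'a::topological_space set \<Rightarrow> bool" where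
  "comeager G \<longleftrightarrow>
     (\<exists>\<D>. countable \<D> \<and> (\<forall>D\<in>\<D>. open D \<and> closure D = UNIV) \<and> \<Inter>\<D> \<subseteq> G)"

lemma comeager_UNIV: "comeager UNIV"
  unfolding comeager_def by (intro exI[of _ "{}"]) auto

lemma comeager_dense_open: "open D \<Longrightarrow> closure D = UNIV \<Longrightarrow> comeager D"
  unfolding comeager_def by (intro exI[of _ "{D}"]) auto

lemma comeager_INT:
  assumes "countable I" and "\<And>i. i \<in> I \<Longrightarrow> comeager (G i)"
  shows "comeager (\<Inter>i\<in>I. G i)"
proof -
  obtain \<D> where \<D>: "\<And>i. i \<in> I \<Longrightarrow> countable (\<D> i)"
      "\<And>i D. i \<in> I \<Longrightarrow> D \<in> \<D> i \<Longrightarrow> open D \<and> closure D = UNIV"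
      "\<And>i. i \<in> I \<Longrightarrow> \<Inter>(\<D> i) \<subseteq> G i"
    using assms(2) unfolding comeager_def by metis
  show ?thesis
    unfolding comeager_def
  proof (intro exI conjI)
    show "countable (\<Union>i\<in>I. \<D> i)"
      using assms(1) \<D>(1) by blast
    show "\<forall>D\<in>\<Union>i\<in>I. \<D> i. open D \<and> closure D = UNIV"
      using \<D>(2) by blast
    show "\<Inter>(\<Union>i\<in>I. \<D> i) \<subseteq> (\<Inter>i\<in>I. G i)"
      using \<D>(3) by blast
  qed
qed

lemma comeager_Int:
  assumes "comeager G" and "comeager H"
  shows "comeager (G \<inter> H)"
proof -
  have "comeager (\<Inter>b\<in>UNIV. if b then G else H)"
    using assms by (intro comeager_INT) auto
  moreover have "(\<Inter>b\<in>UNIV. if b then G else H) = G \<inter> H"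
    by (auto split: if_splits)
  ultimately show ?thesis by simp
qed

text \<open>
  This is the Baire property of Borel sets. The sets with the property contain the open sets and
  form a sigma algebra. For complements, an open \<open>U\<close> that represents \<open>A\<close> is replaced by the
  interior of its complement; the two together miss only the boundary of \<open>U\<close>, which is closed
  and nowhere dense.
\<close>

lemma borel_set_open_on_comeager:
  fixes A :: "'a::topological_space set"
  assumes "A \<in> sets borel"
  shows "\<exists>U G. open U \<and> comeager G \<and> A \<inter> G = U \<inter> G"
proof -
  have "A \<in> sigma_sets UNIV {S. open S}"
    using assms by (simp add: borel_def)
  then show ?thesis
  proof (induction A rule: sigma_sets.induct)
    case (Basic A)
    then show ?case using comeager_UNIV by auto
  next
    case Empty
    then show ?case using comeager_UNIV by auto
  next
    case (Compl A)
    then obtain U G where UG: "open U" "comeager G" "A \<inter> G = U \<inter> G" by blast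
    let ?V = "interior (- U)"
    have "closure (U \<union> ?V) = UNIV"
      using closure_subset[of U] closure_subset[of "- closure U"]
      by (auto simp: interior_closure)
    then have "comeager (U \<union> ?V)"
      using UG(1) by (intro comeager_dense_open) auto
    moreover have "(UNIV - A) \<inter> (G \<inter> (U \<union> ?V)) = ?V \<inter> (G \<inter> (U \<union> ?V))"
      using UG(3) interior_subset[of "- U"] by blast
    moreover have "comeager (G \<inter> (U \<union> ?V))"
      using UG(2) calculation(1) by (rule comeager_Int)
    ultimately show ?case
      by (intro exI[of _ ?V] exI[of _ "G \<inter> (U \<union> ?V)"]) simp
  next
    case (Union A)
    then obtain U G where UG: "\<And>i::nat. open (U i)" "\<And>i. comeager (G i)"
        "\<And>i. A i \<inter> G i = U i \<inter> G i"
      by metis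
    have "comeager (\<Inter>i. G i)" using UG(2) by (intro comeager_INT) auto
    moreover have "(\<Union>i. A i) \<inter> (\<Inter>i. G i) = (\<Union>i. U i) \<inter> (\<Inter>i. G i)"
      using UG(3) by blast
    moreover have "open (\<Union>i. U i)" using UG(1) by auto
    ultimately show ?case
      by (intro exI[of _ "\<Union>i. U i"] exI[of _ "\<Inter>i. G i"]) simp
  qed
qed

text \<open>
  Only countably many preimages, those of a countable basis, have to be made relatively open, so
  the comeager sets on which they are open can be intersected.
\<close>

lemma borel_measurable_continuous_on_comeager:
  fixes f :: "'a::topological_space \<Rightarrow> 'b::second_countable_topology"
  assumes "f \<in> borel_measurable borel"
  shows "\<exists>G. comeager G \<and> continuous_on G f"
proof -
  obtain B :: "'b set set" where B: "countable B" "topological_basis B"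
    using ex_countable_basis by blast
  have "\<exists>U G. open U \<and> comeager G \<and> (f -` b) \<inter> G = U \<inter> G" if "b \<in> B" for b
  proof (rule borel_set_open_on_comeager)
    have "b \<in> sets borel" using that B(2) by (simp add: topological_basis_open)
    then show "f -` b \<in> sets borel" using measurable_sets[OF assms] by simp
  qed
  then obtain U G where UG: "\<And>b. b \<in> B \<Longrightarrow> open (U b)" "\<And>b. b \<in> B \<Longrightarrow> comeager (G b)"
      "\<And>b. b \<in> B \<Longrightarrow> (f -` b) \<inter> G b = U b \<inter> G b"
    by metis
  let ?H = "\<Inter>b\<in>B. G b"
  have "comeager ?H" using B(1) UG(2) by (rule comeager_INT)
  moreover have "continuous_on ?H f"
    unfolding continuous_on_open_invariant
  proof (intro allI impI)
    fix W :: "'b set"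
    assume "open W"
    then obtain C where C: "C \<subseteq> B" "W = \<Union>C"
      using B(2) unfolding topological_basis_def by metis
    have "open (\<Union>b\<in>C. U b)" using C(1) UG(1) by blast
    moreover have "(\<Union>b\<in>C. U b) \<inter> ?H = f -` W \<inter> ?H"
      using C UG(3) by blast
    ultimately show "\<exists>A. open A \<and> A \<inter> ?H = f -` W \<inter> ?H" by blast
  qed
  ultimately show ?thesis by blast
qed

text \<open>
  As a countable product of \<open>bool\<close>, Cantor space is then second countable too, as the values of \<open>f\<close>
  must be for \<open>borel_measurable_continuous_on_comeager\<close>.
\<close>

instance bool :: second_countable_topology
proof
  have "open = generate_topology (UNIV :: bool set set)"
    by (auto simp: fun_eq_iff open_discrete intro: generate_topology.Basis)
  then show "\<exists>B::bool set set. countable B \<and> open = generate_topology B"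
    by (intro exI[of _ UNIV]) (simp add: countable_finite)
qed

section \<open>Subcubes of comeager subsets of Cantor space\<close>

lemma open_contains_cylinder:
  fixes x :: "nat \<Rightarrow> 'a::topological_space"
  assumes "open E" and "x \<in> E"
  obtains m where "\<And>y. (\<And>i. i < m \<Longrightarrow> y i = x i) \<Longrightarrow> y \<in> E"
proof -
  obtain X where X: "x \<in> Pi\<^sub>E UNIV X" "finite {i. X i \<noteq> UNIV}" "Pi\<^sub>E UNIV X \<subseteq> E"
    using product_topology_open_contains_basis[of "\<lambda>_. euclidean" UNIV E x] assms
    unfolding open_fun_def topspace_euclidean by metis
  obtain m where "{i. X i \<noteq> UNIV} \<subseteq> {..<m}"
    using X(2) finite_nat_bounded by blast
  then have m: "X i \<noteq> UNIV \<Longrightarrow> i < m" for i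
    by auto
  have "y \<in> E" if "\<And>i. i < m \<Longrightarrow> y i = x i" for y
  proof -
    have "y i \<in> X i" for i
      using m[of i] that[of i] PiE_mem[OF X(1), of i] by (cases "X i = UNIV") simp_all
    then show ?thesis using X(3) by (auto simp: PiE_iff)
  qed
  then show ?thesis by (rule that)
qed

lemma dense_open_Int_flip:
  fixes E :: "(nat \<Rightarrow> bool) set" and k :: nat
  assumes "open E" and "closure E = UNIV"
  defines "F \<equiv> E \<inter> (\<lambda>x. x(k := \<not> x k)) -` E"
  shows "open F" and "closure F = UNIV"
proof -
  let ?\<phi> = "\<lambda>x::nat \<Rightarrow> bool. x(k := \<not> x k)"
  have cont: "continuous_on UNIV ?\<phi>"
  proof (rule continuous_on_coordinatewise_then_product)
    fix i
    have "continuous_on UNIV (\<lambda>x::nat \<Rightarrow> bool. \<not> x k)"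
      using continuous_on_compose2[of UNIV Not UNIV "\<lambda>x::nat \<Rightarrow> bool. x k"]
      by auto
    then show "continuous_on UNIV (\<lambda>x. ?\<phi> x i)"
      by (cases "i = k") auto
  qed
  have vimage: "open (?\<phi> -` W)" if "open W" for W
    using cont that by (simp add: open_vimage)
  show "open F" unfolding F_def using assms(1) vimage by blast
  have F_meets: "F \<inter> W \<noteq> {}" if W: "open W" "W \<noteq> {}" for W
  proof -
    have ne: "E \<inter> V \<noteq> {}" if "open V" "V \<noteq> {}" for V
      using that assms(2) open_Int_closure_eq_empty[of V E] by auto
    \<comment> \<open>Density is used twice: for \<open>W\<close>, and for the flipped copy of \<open>E \<inter> W\<close>.\<close>
    obtain x where "x \<in> W" "x \<in> E" using ne[OF W] by blast
    then have "?\<phi> x \<in> ?\<phi> -` (E \<inter> W)" by simp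
    then obtain y where "y \<in> E" "y \<in> ?\<phi> -` (E \<inter> W)"
      using ne[of "?\<phi> -` (E \<inter> W)"] vimage[of "E \<inter> W"] assms(1) W(1) by blast
    then have "?\<phi> y \<in> F \<inter> W" by (simp add: F_def)
    then show ?thesis by blast
  qed
  then show "closure F = UNIV"
    using F_meets[of "- closure F"] closure_subset[of F] by blast
qed

text \<open>
  Membership in \<open>D\<close> is made robust against changes of the first \<open>k\<close> coordinates by protecting one
  coordinate at a time: intersecting a set with its flipped copy makes it invariant under
  flipping that coordinate.
\<close>

lemma dense_open_tail_invariant:
  fixes D :: "(nat \<Rightarrow> bool) set"
  assumes "open D" and "closure D = UNIV"
  shows "\<exists>E. open E \<and> closure E = UNIV \<and>
           (\<forall>x\<in>E. \<forall>y. (\<forall>i\<ge>k. y i = x i) \<longrightarrow> y \<in> D)"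
proof (induction k)
  case 0
  have "y = x" if "\<forall>i\<ge>0. y i = x i" for x y :: "nat \<Rightarrow> bool"
    using that by auto
  then show ?case using assms by blast
next
  case (Suc k)
  then obtain E where E: "open E" "closure E = UNIV"
      "\<And>x y. x \<in> E \<Longrightarrow> (\<And>i. i \<ge> k \<Longrightarrow> y i = x i) \<Longrightarrow> y \<in> D"
    by metis
  let ?F = "E \<inter> (\<lambda>x. x(k := \<not> x k)) -` E"
  have "y \<in> D" if x: "x \<in> ?F" and y: "\<forall>i\<ge>Suc k. y i = x i" for x y
  proof (cases "y k = x k")
    case True
    have "y i = x i" if "i \<ge> k" for i
      using that True y by (cases "i = k") auto
    then show ?thesis using E(3)[of x y] x by blast
  next
    case False
    have "y i = (x(k := \<not> x k)) i" if "i \<ge> k" for i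
      using that False y by (cases "i = k") auto
    then show ?thesis using E(3)[of "x(k := \<not> x k)" y] x by blast
  qed
  then show ?case using dense_open_Int_flip[OF E(1,2), of k] by blast
qed

text \<open>
  The values in the block \<open>{k..<m}\<close> alone force membership in \<open>D\<close>; the coordinates below \<open>k\<close> stay
  arbitrary. They are handled by replacing a point with one of a set \<open>E\<close> whose points may be
  changed below \<open>k\<close> without leaving \<open>D\<close>.
\<close>

lemma dense_open_contains_block:
  fixes D :: "(nat \<Rightarrow> bool) set"
  assumes "open D" and "closure D = UNIV"
  shows "\<exists>m s. k \<le> m \<and> (\<forall>y. (\<forall>i. k \<le> i \<and> i < m \<longrightarrow> y i = s i) \<longrightarrow> y \<in> D)"
proof -
  obtain E where E: "open E" "closure E = UNIV"
      "\<And>x y. x \<in> E \<Longrightarrow> (\<And>i. i \<ge> k \<Longrightarrow> y i = x i) \<Longrightarrow> y \<in> D"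
    using dense_open_tail_invariant[OF assms, of k] by metis
  have "E \<noteq> {}" using E(2) by auto
  then obtain x where "x \<in> E" by blast
  obtain m where m: "\<And>y. (\<And>i. i < m \<Longrightarrow> y i = x i) \<Longrightarrow> y \<in> E"
    using open_contains_cylinder[OF E(1) \<open>x \<in> E\<close>] by blast
  have "y \<in> D" if y: "\<forall>i. k \<le> i \<and> i < max k m \<longrightarrow> y i = x i" for y
  proof -
    have "(\<lambda>i. if i < k then x i else y i) \<in> E"
      using y by (intro m) auto
    then show ?thesis by (rule E(3)) simp
  qed
  then show ?thesis by (intro exI[of _ "max k m"] exI[of _ x]) auto
qed

text \<open>
  With \<open>K n\<close> the start of the \<open>n\<close>-th block and \<open>M n (K n)\<close> its end, the coordinate \<open>M n (K n)\<close> is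
  left free and the next block starts right after it. All other coordinates are fixed to the
  values \<open>S n (K n)\<close> of their block.
\<close>

lemma comeager_contains_subcube:
  fixes G :: "(nat \<Rightarrow> bool) set"
  assumes "comeager G"
  shows "\<exists>\<rho>. infinite (preserved \<rho>) \<and> range (fill_in \<rho>) \<subseteq> G"
proof -
  obtain \<D> where \<D>: "countable \<D>" "\<And>D. D \<in> \<D> \<Longrightarrow> open D \<and> closure D = UNIV" "\<Inter>\<D> \<subseteq> G"
    using assms unfolding comeager_def by metis
  \<comment> \<open>The whole space is added because \<open>\<D>\<close> may be empty, and then has no enumeration.\<close>
  define D where "D = from_nat_into (insert UNIV \<D>)"
  have range_D: "range D = insert UNIV \<D>"
    unfolding D_def using \<D>(1) by (intro range_from_nat_into) auto
  have D: "open (D n) \<and> closure (D n) = UNIV" for n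
    using \<D>(2) range_D by (metis closure_UNIV insert_iff open_UNIV rangeI)
  have "\<forall>n k. \<exists>m s. k \<le> m \<and> (\<forall>y. (\<forall>i. k \<le> i \<and> i < m \<longrightarrow> y i = s i) \<longrightarrow> y \<in> D n)"
    using D by (intro allI dense_open_contains_block) simp_all
  then obtain M S where
    "\<forall>n k. k \<le> M n k \<and> (\<forall>y. (\<forall>i. k \<le> i \<and> i < M n k \<longrightarrow> y i = S n k i) \<longrightarrow> y \<in> D n)"
    unfolding choice_iff by (elim exE)
  then have MS: "k \<le> M n k"
      "(\<And>i. k \<le> i \<Longrightarrow> i < M n k \<Longrightarrow> y i = S n k i) \<Longrightarrow> y \<in> D n" for n k y
    by blast+
  define K where "K = rec_nat 0 (\<lambda>n k. Suc (M n k))"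
  have K_Suc: "K (Suc n) = Suc (M n (K n))" for n
    by (simp add: K_def)
  have "strict_mono K"
    unfolding strict_mono_Suc_iff using MS(1) by (simp add: K_Suc less_Suc_eq_le)
  \<comment> \<open>The least such \<open>n\<close> is the index of the block, including the free coordinate that ends it,
    to which \<open>i\<close> belongs.\<close>
  define \<rho> :: restriction where
    "\<rho> i = (let n = (LEAST n. i < K (Suc n)) in
            if i = M n (K n) then None else Some (S n (K n) i))" for i
  have block: "\<rho> i = (if i = M n (K n) then None else Some (S n (K n) i))"
    if "K n \<le> i" "i \<le> M n (K n)" for n i
  proof -
    have "(LEAST n. i < K (Suc n)) = n"
    proof (rule Least_equality)
      show "i < K (Suc n)" using that by (simp add: K_Suc)
      show "n \<le> j" if "i < K (Suc j)" for j
      proof -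
        have "K n < K (Suc j)" using that \<open>K n \<le> i\<close> by simp
        then show ?thesis using \<open>strict_mono K\<close> by (simp add: strict_mono_less)
      qed
    qed
    then show ?thesis by (simp add: \<rho>_def)
  qed
  have "M n (K n) \<in> preserved \<rho>" for n
    using block[of n "M n (K n)"] MS(1) by (simp add: preserved_def)
  then have "range (\<lambda>n. M n (K n)) \<subseteq> preserved \<rho>"
    by blast
  moreover have "strict_mono (\<lambda>n. M n (K n))"
    unfolding strict_mono_Suc_iff using MS(1) K_Suc by (metis Suc_le_eq)
  then have "infinite (range (\<lambda>n. M n (K n)))"
    by (intro range_inj_infinite strict_mono_imp_inj_on)
  ultimately have inf: "infinite (preserved \<rho>)"
    using infinite_super by blast
  have in_D: "fill_in \<rho> x \<in> D n" for x n
  proof (rule MS(2))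
    show "fill_in \<rho> x i = S n (K n) i" if "K n \<le> i" "i < M n (K n)" for i
      using block[of n i] that by (simp add: fill_in_def)
  qed
  have "fill_in \<rho> x \<in> G" for x
  proof -
    have "\<Inter>(range D) \<subseteq> \<Inter>\<D>"
      unfolding range_D by blast
    moreover have "fill_in \<rho> x \<in> \<Inter>(range D)"
      using in_D by blast
    ultimately show ?thesis
      using \<D>(3) by blast
  qed
  then show ?thesis using inf by blast
qed

section \<open>Restricting a Borel function\<close>

lemma continuous_map_fill_in: "continuous_map (restricted_cube \<rho>) euclidean (fill_in \<rho>)"
proof -
  have "continuous_map (restricted_cube \<rho>) euclidean (\<lambda>x. fill_in \<rho> x i)" for i
  proof (cases "\<rho> i")
    case None
    then have "i \<in> preserved \<rho>" by (simp add: preserved_def)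
    then have "continuous_map (restricted_cube \<rho>) (discrete_topology UNIV) (\<lambda>x. x i)"
      unfolding restricted_cube_def by (rule continuous_map_product_projection)
    then show ?thesis
      using None continuous_map_compose[of _ "discrete_topology UNIV" "\<lambda>x. x i" euclidean id]
      by (simp add: fill_in_def comp_def)
  next
    case (Some b)
    then show ?thesis by (simp add: fill_in_def)
  qed
  then show ?thesis
    unfolding euclidean_product_topology[symmetric] continuous_map_componentwise_UNIV by blast
qed

theorem theorem4p3:
  fixes f :: "(nat \<Rightarrow> bool) \<Rightarrow> (nat \<Rightarrow> bool)"
  assumes "f \<in> borel_measurable borel"
  shows "\<exists>\<rho> :: restriction. infinite (preserved \<rho>) \<and>
           continuous_map (restricted_cube \<rho>) euclidean (restricted_fun f \<rho>)"
proof -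
  obtain G where G: "comeager G" "continuous_on G f"
    using borel_measurable_continuous_on_comeager[OF assms] by blast
  obtain \<rho> where \<rho>: "infinite (preserved \<rho>)" "range (fill_in \<rho>) \<subseteq> G"
    using comeager_contains_subcube[OF G(1)] by blast
  have "continuous_map (restricted_cube \<rho>) (top_of_set G) (fill_in \<rho>)"
    using continuous_map_fill_in \<rho>(2) by (auto simp: continuous_map_in_subtopology)
  moreover have "continuous_map (top_of_set G) euclidean f"
    using G(2) by simp
  ultimately have "continuous_map (restricted_cube \<rho>) euclidean (f \<circ> fill_in \<rho>)"
    by (rule continuous_map_compose)
  then have "continuous_map (restricted_cube \<rho>) euclidean (restricted_fun f \<rho>)"
    by (rule continuous_map_eq) (simp add: restricted_fun_def)
  then show ?thesis using \<rho>(1) by blast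
qed

end
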